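(* For every $\delta\in\mathbb{N}_+$ there exist $r_1,r_2\in\mathbb{Z}$ and a sequence of integers $(U_n)_{n\ge0}$ with $U_n=r_1U_{n-1}+r_2U_{n-2}$ for all $n\ge2$, such that the discriminant $\Delta=r_1^2+4r_2$ of $x^2-r_1x-r_2$ satisfies $\sqrt{\Delta}=\delta$ and $\operatorname{rad}(\Delta)$ divides $\operatorname{fail}(\mathbf U)$.
   Context: A sequence of integers $(A_n)_{n\ge1}$ satisfies the Dold condition if $n\mid\sum_{d\mid n}\mu(d)A_{n/d}$ for every $n\in\mathbb{N}_+$ ($\mu$ the Möbius function). For a sequence $\mathbf U$, $\operatorname{fail}(\mathbf U)$ is the least positive integer $c$ such that $(cU_n)_{n\ge1}$ satisfies the Dold condition ($\infty$ if no such $c$ exists). For a nonzero integer $m$, $\operatorname{rad}(m)$ denotes the product of the distinct primes dividing $m$. *)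

theory Defs
  imports Complex_Main
    "HOL-Library.Extended_Nat"
    "HOL-Computational_Algebra.Primes"
    "HOL-Computational_Algebra.Squarefree"
begin

definition moebius_mu :: "nat \<Rightarrow> int" where
  "moebius_mu n = (if squarefree n then (-1) ^ card (prime_factors n) else 0)"

text \<open>Only the values at positive indices matter; the value at 0 is ignored.\<close>

definition dold :: "(nat \<Rightarrow> int) \<Rightarrow> bool" where
  "dold A \<longleftrightarrow> (\<forall>n>0. int n dvd (\<Sum>d | d dvd n. moebius_mu d * A (n div d)))"

definition fail :: "(nat \<Rightarrow> int) \<Rightarrow> enat" where
  "fail U = (if \<exists>c>0. dold (\<lambda>n. int c * U n)
             then enat (LEAST c. c > 0 \<and> dold (\<lambda>n. int c * U n))
             else \<infinity>)"

definition rad :: "int \<Rightarrow> int" where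
  "rad m = (\<Prod>p\<in>prime_factors m. p)"

end

theory Submission
  imports Defs "HOL-Number_Theory.Residues"
begin

text \<open>
  Take the roots \<delta> and 0, that is \<^term>\<open>U n = \<delta> ^ (n - 1)\<close> for positive n. Then
  \<delta> U is the sequence of powers of \<delta>, which satisfies the Dold condition, so the failure is finite:
  for n = p^(k+1) m with p prime to m, the Moebius sum groups into differences b^(p^(k+1)) - b^(p^k),
  each divisible by p^(k+1) by Fermat's little theorem.
  Conversely, if c U satisfies the Dold condition and p is a prime divisor of \<delta>, then the condition
  at n = p says that p divides \<^term>\<open>c * \<delta> ^ (p - 1) - c\<close>, hence p divides c.
\<close>

text \<open>Each passage to \<open>p\<close>-th powers gains one factor \<open>p\<close>:
  \<open>X ^ p - Y ^ p\<close> is \<open>X - Y\<close> times a sum of \<open>p\<close> terms, and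
  modulo \<open>p\<close> these all equal \<open>Y ^ (p - 1)\<close>, so the sum vanishes.\<close>

lemma prime_power_dvd_diff_powers:
  fixes x y :: int
  assumes "int p dvd x - y"
  shows "int p ^ Suc j dvd x ^ (p ^ j) - y ^ (p ^ j)"
proof (induction j)
  case 0
  then show ?case using assms by simp
next
  case (Suc j)
  define X Y where "X = x ^ (p ^ j)" and "Y = y ^ (p ^ j)"
  have IH: "int p ^ Suc j dvd X - Y"
    using Suc.IH by (simp add: X_def Y_def)
  then have "int p dvd X - Y"
    by (metis dvd_mult_left power_Suc)
  then have XY: "[X = Y] (mod int p)"
    by (simp add: cong_iff_dvd_diff)
  have "[(\<Sum>i<p. Y ^ (p - Suc i) * X ^ i) = (\<Sum>i<p. Y ^ (p - Suc i) * Y ^ i)] (mod int p)"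
    by (intro cong_sum cong_mult cong_pow cong_refl XY)
  also have "(\<Sum>i<p. Y ^ (p - Suc i) * Y ^ i) = (\<Sum>i<p. Y ^ (p - 1))"
    by (intro sum.cong refl) (simp flip: power_add)
  also have "[\<dots> = 0] (mod int p)"
    by (simp add: cong_0_iff)
  finally have "int p dvd (\<Sum>i<p. Y ^ (p - Suc i) * X ^ i)"
    by (simp add: cong_0_iff)
  with IH have "int p ^ Suc j * int p dvd (X - Y) * (\<Sum>i<p. Y ^ (p - Suc i) * X ^ i)"
    by (rule mult_dvd_mono)
  then have "int p ^ Suc (Suc j) dvd X ^ p - Y ^ p"
    by (simp only: power_diff_sumr2 power_Suc2)
  then show ?case
    by (simp add: X_def Y_def power_mult [symmetric] mult.commute)
qed

lemma prime_dvd_power_prime_diff: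
  fixes a :: nat
  assumes "prime p"
  shows "int p dvd int a ^ p - int a"
proof -
  \<comment> \<open>In factored form \<open>p\<close> divides either the first factor or, by Fermat,
    the second.\<close>
  have "int p dvd int a * (int a ^ (p - 1) - 1)"
  proof (cases "p dvd a")
    case False
    with assms have "[a ^ (p - 1) = 1] (mod p)"
      by (rule fermat_theorem)
    then have "[int a ^ (p - 1) = 1] (mod int p)"
      by (metis cong_int_iff of_nat_1 of_nat_power)
    then show ?thesis
      by (simp add: cong_iff_dvd_diff)
  qed simp
  moreover have "int a * (int a ^ (p - 1) - 1) = int a ^ p - int a"
    using prime_gt_0_nat [OF assms]
    by (simp add: right_diff_distrib flip: power_Suc)
  ultimately show ?thesis by simp
qed

lemma moebius_mu_1 [simp]: "moebius_mu (Suc 0) = 1"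
  by (simp add: moebius_mu_def)

text \<open>A new prime keeps squarefreeness in both directions and adds one prime factor, which
  flips the sign; otherwise both sides are 0.\<close>

lemma moebius_mu_prime_mult:
  assumes "prime p" "\<not> p dvd d"
  shows "moebius_mu (p * d) = - moebius_mu d"
proof -
  have d: "d \<noteq> 0" using assms by (cases d) auto
  have "coprime p d"
    using assms by (simp add: prime_imp_coprime)
  then have "squarefree (p * d) \<longleftrightarrow> squarefree d"
    using assms(1) by (auto simp: squarefree_mult_coprime squarefree_prime
        dest: squarefree_multD)
  moreover have "prime_factors (p * d) = insert p (prime_factors d)"
    using assms(1) d by (simp add: prime_factors_product prime_prime_factors)
  moreover have "p \<notin> prime_factors d"
    using assms(2) by auto
  ultimately show ?thesis
    by (simp add: moebius_mu_def)
qed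

text \<open>A squarefree divisor of \<open>p ^ Suc k * m\<close> contains \<open>p\<close> at most
  once, so it is \<open>d\<close> or \<open>p * d\<close> with \<open>d\<close> dividing
  \<open>m\<close>. These two have opposite signs and pair up into a difference.\<close>

lemma sum_moebius_mu_prime_power:
  fixes A :: "nat \<Rightarrow> int"
  assumes p: "prime p" and m: "m > 0" "\<not> p dvd m"
  shows "(\<Sum>d | d dvd p ^ Suc k * m. moebius_mu d * A (p ^ Suc k * m div d)) =
         (\<Sum>d | d dvd m. moebius_mu d * (A (p ^ Suc k * (m div d)) - A (p ^ k * (m div d))))"
proof -
  define n where "n = p ^ Suc k * m"
  define f where "f d = moebius_mu d * A (n div d)" for d
  define D where "D = {d. d dvd m}"
  have p0: "p > 0" using p by (rule prime_gt_0_nat)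
  have n0: "n > 0" using p0 m by (simp add: n_def)
  have fin: "finite D" using m by (simp add: D_def)
  have notp: "\<not> p dvd d" if "d \<in> D" for d
    using that m(2) dvd_trans by (auto simp: D_def)
  have mem: "d \<in> D \<union> (*) p ` D" if "d dvd n" and sf: "squarefree d" for d
  proof (cases "p dvd d")
    case False
    then have "coprime d (p ^ Suc k)"
      using p by (metis coprime_commute coprime_power_right_iff prime_imp_coprime)
    then show ?thesis
      using that(1) by (simp add: D_def n_def coprime_dvd_mult_right_iff del: power_Suc)
  next
    case True
    then obtain e where e: "d = p * e" by blast
    have "\<not> p dvd e"
    proof
      assume "p dvd e"
      then have "p ^ 2 dvd d" by (auto simp: e power2_eq_square)
      with sf have "p dvd 1" by (rule squarefreeD)
      with p show False by simp
    qed
    then have "coprime e (p ^ k)"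
      using p by (metis coprime_commute coprime_power_right_iff prime_imp_coprime)
    moreover have "e dvd p ^ k * m"
      using that(1) p0 by (simp add: e n_def mult.assoc)
    ultimately have "e \<in> D"
      by (simp add: D_def coprime_dvd_mult_right_iff)
    then show ?thesis by (auto simp: e)
  qed
  have "(\<Sum>d | d dvd n. f d) = (\<Sum>d\<in>D \<union> (*) p ` D. f d)"
  proof (rule sum.mono_neutral_right)
    show "finite {d. d dvd n}" using n0 by simp
    show "D \<union> (*) p ` D \<subseteq> {d. d dvd n}"
      by (auto simp: D_def n_def mult.assoc intro: mult_dvd_mono)
    show "\<forall>d\<in>{d. d dvd n} - (D \<union> (*) p ` D). f d = 0"
    proof
      fix d assume "d \<in> {d. d dvd n} - (D \<union> (*) p ` D)"
      then have "\<not> squarefree d" using mem by blast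
      then show "f d = 0" by (simp add: f_def moebius_mu_def)
    qed
  qed
  \<comment> \<open>The union is disjoint: \<open>p\<close> divides everything in the image and
    nothing in \<open>D\<close>.\<close>
  also have "\<dots> = (\<Sum>d\<in>D. f d) + (\<Sum>d\<in>(*) p ` D. f d)"
    using fin notp by (intro sum.union_disjoint) (auto dest!: notp)
  also have "(\<Sum>d\<in>(*) p ` D. f d) = (\<Sum>d\<in>D. f (p * d))"
    using p0 by (subst sum.reindex) (auto simp: inj_on_def)
  also have "(\<Sum>d\<in>D. f d) + (\<Sum>d\<in>D. f (p * d)) = (\<Sum>d\<in>D. f d + f (p * d))"
    by (simp add: sum.distrib)
  also have "\<dots> = (\<Sum>d\<in>D. moebius_mu d * (A (p ^ Suc k * (m div d)) - A (p ^ k * (m div d))))"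
  proof (rule sum.cong)
    fix d assume d: "d \<in> D"
    then have dm: "d dvd m" by (simp add: D_def)
    have "n div d = p ^ Suc k * (m div d)"
      unfolding n_def using dm by (rule div_mult_swap [symmetric])
    moreover have "n div (p * d) = p ^ k * (m div d)"
      using p0 dm by (simp add: n_def mult.assoc div_mult_swap)
    ultimately show "f d + f (p * d) =
        moebius_mu d * (A (p ^ Suc k * (m div d)) - A (p ^ k * (m div d)))"
      using moebius_mu_prime_mult [OF p notp [OF d]]
      by (simp add: f_def right_diff_distrib)
  qed simp
  finally show ?thesis
    by (simp add: f_def n_def D_def)
qed

text \<open>Multiplicities are compared prime by prime. The hypothesis names the cofactor
  \<open>m\<close> to match the pairing of the Moebius sum.\<close>

lemma dvd_if_prime_powers_dvd:
  fixes n :: nat and s :: int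
  assumes "n > 0"
    and pp: "\<And>p k m. prime p \<Longrightarrow> n = p ^ Suc k * m \<Longrightarrow> \<not> p dvd m \<Longrightarrow> int p ^ Suc k dvd s"
  shows "int n dvd s"
\<comment> \<open>Zero is split off because its multiplicity is 0 by convention, although everything
  divides it.\<close>
proof (cases "s = 0")
  case False
  have "n dvd nat \<bar>s\<bar>"
  proof (rule multiplicity_le_imp_dvd)
    fix p :: nat assume p: "prime p"
    show "multiplicity p n \<le> multiplicity p (nat \<bar>s\<bar>)"
    proof (cases "multiplicity p n")
      case (Suc k)
      obtain m where m: "n = p ^ multiplicity p n * m" "\<not> p dvd m"
        using multiplicity_decompose' [of n p] assms(1) not_prime_unit p by blast
      then have "int p ^ Suc k dvd s"
        using pp [OF p] Suc by metis
      then have "p ^ Suc k dvd nat \<bar>s\<bar>"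
        by (metis int_dvd_int_iff of_nat_power dvd_abs_iff abs_ge_zero int_nat_eq)
      then show ?thesis
        using False p Suc by (metis multiplicity_geI not_prime_unit zero_less_abs_iff
            zero_less_nat_eq less_numeral_extra(3))
    qed simp
  qed (use assms(1) False in auto)
  then show ?thesis
    by (metis int_dvd_int_iff dvd_abs_iff abs_ge_zero int_nat_eq)
qed simp

lemma dold_power: "dold (\<lambda>n. int a ^ n)"
  unfolding dold_def
proof (intro allI impI)
  fix n :: nat assume n: "n > 0"
  show "int n dvd (\<Sum>d | d dvd n. moebius_mu d * int a ^ (n div d))"
  proof (rule dvd_if_prime_powers_dvd [OF n])
    fix p k m assume p: "prime p" and nm: "n = p ^ Suc k * m" and m: "\<not> p dvd m"
    have "m > 0" using n nm by (cases m) auto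
    \<comment> \<open>Here \<open>e\<close> stands for \<open>m div d\<close>. With b =
      \<open>a ^ e\<close>, Fermat gives b^p = b modulo \<open>p\<close>, and raising to the power
      \<open>p ^ k\<close> lifts this to modulus \<open>p ^ Suc k\<close>.\<close>
    have "int p ^ Suc k dvd int a ^ (p ^ Suc k * e) - int a ^ (p ^ k * e)" for e
    proof -
      have "int p ^ Suc k dvd (int (a ^ e) ^ p) ^ (p ^ k) - int (a ^ e) ^ (p ^ k)"
        by (intro prime_power_dvd_diff_powers prime_dvd_power_prime_diff p)
      then show ?thesis
        by (simp add: power_mult [symmetric] mult_ac)
    qed
    then show "int p ^ Suc k dvd (\<Sum>d | d dvd n. moebius_mu d * int a ^ (n div d))"
      unfolding nm sum_moebius_mu_prime_power [OF p \<open>m > 0\<close> m]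
      by (intro dvd_sum dvd_mult)
  qed
qed

lemma dold_primeD:
  assumes "dold A" "prime p"
  shows "int p dvd A p - A 1"
proof -
  have p: "p > 1" using assms(2) by (rule prime_gt_1_nat)
  have "{d. d dvd p} = {1, p}"
    using assms(2) by (auto simp: prime_nat_iff)
  moreover have "moebius_mu p = -1"
    using assms(2) p moebius_mu_prime_mult [of p 1] by simp
  ultimately have "(\<Sum>d | d dvd p. moebius_mu d * A (p div d)) = A p - A 1"
    using p by simp
  moreover have "int p dvd (\<Sum>d | d dvd p. moebius_mu d * A (p div d))"
    using assms(1) p by (simp add: dold_def)
  ultimately show ?thesis by simp
qed

text \<open>Integer primes are positive, so distinct ones are coprime and their divisibilities
  multiply. This reduces a claim about \<open>rad\<close> to single primes.\<close>

lemma prod_primes_dvd: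
  fixes c :: int
  assumes "finite P" "\<And>p. p \<in> P \<Longrightarrow> prime p" "\<And>p. p \<in> P \<Longrightarrow> p dvd c"
  shows "\<Prod>P dvd c"
  using assms
proof (induction P rule: finite_induct)
  case (insert p P)
  then have "coprime p (\<Prod>P)"
    by (intro prod_coprime_right primes_coprime) auto
  with insert show ?case
    by (simp add: divides_mult)
qed simp

theorem theorem3:
  fixes \<delta> :: nat
  assumes "\<delta> > 0"
  shows "\<exists>(r1::int) (r2::int) (U :: nat \<Rightarrow> int).
           (\<forall>n\<ge>2. U n = r1 * U (n - 1) + r2 * U (n - 2)) \<and>
           (let \<Delta> = r1\<^sup>2 + 4 * r2 in
              sqrt (real_of_int \<Delta>) = real \<delta> \<and>
              (\<exists>c. fail U = enat c \<and> rad \<Delta> dvd int c))"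
proof -
  \<comment> \<open>Truncated subtraction makes \<open>U 0 = 1\<close>; this value enters the
    recurrence only with coefficient 0.\<close>
  define U :: "nat \<Rightarrow> int" where "U n = int \<delta> ^ (n - 1)" for n
  let ?P = "\<lambda>c. c > 0 \<and> dold (\<lambda>n. int c * U n)"
  define c where "c = (LEAST c. ?P c)"
  have rec: "U n = int \<delta> * U (n - 1) + 0 * U (n - 2)" if "n \<ge> 2" for n
  proof -
    have "n - 1 = Suc (n - 1 - 1)" using that by simp
    then show ?thesis
      by (metis U_def power_Suc mult_zero_left add.right_neutral)
  qed
  \<comment> \<open>At index 0 the sequences \<open>\<delta> * U\<close> and the powers of
    \<open>\<delta>\<close> may differ, so equality is shown for the sums, where only positive
    indices occur.\<close>
  have "(\<Sum>d | d dvd n. moebius_mu d * (int \<delta> * U (n div d))) =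
        (\<Sum>d | d dvd n. moebius_mu d * int \<delta> ^ (n div d))" if "n > 0" for n
  proof (rule sum.cong)
    fix d assume "d \<in> {d. d dvd n}"
    then have "n div d > 0" using that by (auto elim!: dvdE)
    then show "moebius_mu d * (int \<delta> * U (n div d)) = moebius_mu d * int \<delta> ^ (n div d)"
      by (simp add: U_def flip: power_Suc)
  qed simp
  then have P: "?P \<delta>"
    using assms dold_power [of \<delta>] by (simp add: dold_def)
  then have c: "?P c"
    unfolding c_def by (rule LeastI)
  have "fail U = enat c"
    using P by (auto simp: fail_def c_def)
  moreover have "rad ((int \<delta>)\<^sup>2) dvd int c"
    unfolding rad_def
  proof (rule prod_primes_dvd)
    fix q assume q: "q \<in> prime_factors ((int \<delta>)\<^sup>2)"
    then have "prime q" by auto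
    \<comment> \<open>\<open>rad\<close> ranges over integer primes, while the Dold condition needs
      a natural index.\<close>
    then obtain p where p: "q = int p" "prime p"
      by (metis prime_ge_0_int prime_nat_int_transfer zero_le_imp_eq_int)
    have "int p dvd int \<delta>"
      using q p \<open>prime q\<close> by (metis in_prime_factors_imp_dvd prime_dvd_power)
    \<comment> \<open>The positive exponent is what makes \<open>p\<close> divide
      \<open>U p\<close>.\<close>
    moreover have "p - 1 > 0"
      using prime_gt_1_nat [OF p(2)] by simp
    ultimately have "int p dvd int c * U p"
      unfolding U_def by (meson dvd_mult dvd_power dvd_trans)
    \<comment> \<open>Since \<open>U 1 = 1\<close>, the second term is \<open>c\<close>
      itself.\<close>
    moreover have "int p dvd int c * U p - int c * U 1"
      using c p(2) dold_primeD by blast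
    ultimately have "int p dvd int c * U 1"
      by (metis dvd_diff_right_iff dvd_diff_commute)
    then show "q dvd int c" by (simp add: U_def p)
  qed auto
  ultimately show ?thesis
    using rec
    by (intro exI [of _ "int \<delta>"] exI [of _ 0] exI [of _ U]) (auto simp: Let_def)
qed

end
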